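(* For every $m\in\mathbb N=\{1,2,\ldots\}$ and $a\in\overline{K}_c$ the following hold: (i) if $a\ne0$, then $\langle T_1(a)\rangle_m=a^{-q^m}(a-[m])\langle a\rangle_m$; (ii) $\langle a\rangle_{m+1}=-a^{q^{m+1}}\langle T_1(a)\rangle_m^q$; (iii) $\langle T_{-1}(a)\rangle_m=-([1]+a^q)^{q^m}\langle a\rangle_{m-1}^q$; (iv) if $a\ne[m-1]$, then $\langle T_{-1}(a)\rangle_m=-\dfrac{([1]+a^q)^{q^m}}{([m-1]-a)^q}\langle a\rangle_m$. Moreover, for all $a,b\in\overline{K}_c$ and every admissible $c\in\overline{K}_c$, for all $z$ in a sufficiently small neighbourhood of $0$: (v) ${}_2F_1(T_1(a),b;c;az)-{}_2F_1(a,T_1(b);c;bz)=(a-b)\,{}_2F_1(a,b;c;z)$; (vi) if moreover $a^q+[1]\ne0$, then $${}_2F_1(a,b;c;z)-{}_2F_1(a,b;c;z)^q+(c^q-b^q)\,{}_2F_1(a,b;T_1(c);c^{-1}z)^q-(a^q+[1])\,{}_2F_1\big(T_{-1}(a),b;c;(a^q+[1])^{-1}z\big)=0.$$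
   Context: Let $q$ be a power of a prime $p$, $K=\mathbb F_q((x))$ (formal Laurent series over $\mathbb F_q$) with its standard absolute value, and $\overline{K}_c$ the completion of an algebraic closure of $K$; $q$-th roots in $\overline{K}_c$ are unique. For integers $k\ge0$ put $[k]=x^{q^k}-x$ (so $[0]=0$), and $[\infty]=-x$. Let $D_0=1$, $D_m=[m][m-1]^q\cdots[1]^{q^{m-1}}$ for $m\ge1$. For $a\in\overline{K}_c$ define the Pochhammer-type symbol $\langle a\rangle_0=1$ and $$\langle a\rangle_m=([0]-a)^{q^m}([1]-a)^{q^{m-1}}\cdots([m-1]-a)^q,\quad m\ge1.$$ Define $T_1(a)=(a-[1])^{1/q}$ and $T_{-1}(a)=a^q+[1]$ for $a\in\overline{K}_c$ (mutually inverse maps). A parameter $c\in\overline{K}_c$ is admissible if $c\ne[\nu]$ for all $\nu\in\{0,1,2,\ldots\}\cup\{\infty\}$. For $a,b\in\overline{K}_c$ and admissible $c$, the hypergeometric function is $${}_2F_1(a,b;c;z)=\sum_{m=0}^\infty\frac{\langle a\rangle_m\langle b\rangle_m}{\langle c\rangle_m}\,\frac{z^{q^m}}{D_m},$$ a series with positive radius of convergence; ${}_2F_1(\cdots)^q$ denotes the $q$-th power of its value. *)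

theory Defs
  imports
    "HOL-Analysis.Analysis"
    "HOL-Algebra.Algebraic_Closure_Type"
begin

text \<open>
  The absolute value is a separate class parameter because \<open>norm\<close> is constrained to real normed
  vector spaces, which have characteristic 0.
\<close>

class valued_field = field + metric_space +
  fixes vabs :: "'a \<Rightarrow> real"
  assumes dist_vabs: "dist x y = vabs (x - y)"
    and vabs_mult: "vabs (x * y) = vabs x * vabs y"
    and vabs_add_le_max: "vabs (x + y) \<le> max (vabs x) (vabs y)"

definition laurent_abs :: "'k::{field,finite} fls \<Rightarrow> real" where
  "laurent_abs f = (if f = 0 then 0 else real CARD('k) powi (- fls_subdegree f))"

text \<open>
  A completion of an algebraic closure of $K = F_q((x))$, with $F_q$ a finite field type:
  a complete valued field together with an embedding of an algebraic closure of \<open>K\<close> with dense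
  image, such that the absolute value extends that of \<open>K\<close>. The absolute value of the
  algebraic closure is the one induced by the embedding; no other one extends that of \<open>K\<close>.
\<close>

definition completed_alg_closure ::
  "('k::{field,finite} fls alg_closure \<Rightarrow> 'c::{valued_field,complete_space}) \<Rightarrow> bool" where
  "completed_alg_closure \<iota> \<longleftrightarrow>
     \<iota> 1 = 1 \<and> (\<forall>u v. \<iota> (u + v) = \<iota> u + \<iota> v) \<and> (\<forall>u v. \<iota> (u * v) = \<iota> u * \<iota> v) \<and>
     (\<forall>f. vabs (\<iota> (to_ac f)) = laurent_abs f) \<and>
     closure (range \<iota>) = UNIV"

text \<open>
  In the following, \<open>q\<close> is the cardinality of the finite field and \<open>x\<close> the image of the
  indeterminate. The elements $[k]$ and $[\infty]$ are \<open>bracket q x k\<close> and \<open>bracket_inf x\<close>.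
\<close>

definition bracket :: "nat \<Rightarrow> 'c::field \<Rightarrow> nat \<Rightarrow> 'c" where
  "bracket q x k = x ^ (q ^ k) - x"

definition bracket_inf :: "'c::field \<Rightarrow> 'c" where
  "bracket_inf x = - x"

definition carlitz_D :: "nat \<Rightarrow> 'c::field \<Rightarrow> nat \<Rightarrow> 'c" where
  "carlitz_D q x m = (\<Prod>i<m. bracket q x (m - i) ^ (q ^ i))"

definition poch :: "nat \<Rightarrow> 'c::field \<Rightarrow> 'c \<Rightarrow> nat \<Rightarrow> 'c" where
  "poch q x a m = (\<Prod>i<m. (bracket q x i - a) ^ (q ^ (m - i)))"

definition qroot :: "nat \<Rightarrow> 'c::field \<Rightarrow> 'c" where
  "qroot q y = (THE w. w ^ q = y)"

definition T_pos :: "nat \<Rightarrow> 'c::field \<Rightarrow> 'c \<Rightarrow> 'c" where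
  "T_pos q x a = qroot q (a - bracket q x 1)"

definition T_neg :: "nat \<Rightarrow> 'c::field \<Rightarrow> 'c \<Rightarrow> 'c" where
  "T_neg q x a = a ^ q + bracket q x 1"

definition admissible :: "nat \<Rightarrow> 'c::field \<Rightarrow> 'c \<Rightarrow> bool" where
  "admissible q x c \<longleftrightarrow> (\<forall>\<nu>. c \<noteq> bracket q x \<nu>) \<and> c \<noteq> bracket_inf x"

definition hyp_term :: "nat \<Rightarrow> 'c::field \<Rightarrow> 'c \<Rightarrow> 'c \<Rightarrow> 'c \<Rightarrow> 'c \<Rightarrow> nat \<Rightarrow> 'c" where
  "hyp_term q x a b c z m =
     poch q x a m * poch q x b m / poch q x c m * (z ^ (q ^ m) / carlitz_D q x m)"

definition hyp2F1 :: "nat \<Rightarrow> 'c::valued_field \<Rightarrow> 'c \<Rightarrow> 'c \<Rightarrow> 'c \<Rightarrow> 'c \<Rightarrow> 'c" where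
  "hyp2F1 q x a b c z = (\<Sum>m. hyp_term q x a b c z m)"


lemma vabs_0 [simp]: "vabs (0::'a::valued_field) = 0"
  by (metis dist_vabs dist_self diff_self)

lemma vabs_eq_0 [simp]: "vabs (u::'a::valued_field) = 0 \<longleftrightarrow> u = 0"
  by (metis dist_vabs dist_eq_0_iff diff_zero)

lemma vabs_ge_0 [simp]: "0 \<le> vabs (u::'a::valued_field)"
  by (metis dist_vabs zero_le_dist diff_zero)

lemma vabs_1 [simp]: "vabs (1::'a::valued_field) = 1"
  using vabs_mult[of "1::'a" 1] by simp

lemma vabs_minus [simp]: "vabs (- u::'a::valued_field) = vabs u"
  by (metis dist_vabs dist_commute diff_zero diff_0)

lemma vabs_power: "vabs (u ^ n :: 'a::valued_field) = vabs u ^ n"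
  by (induction n) (auto simp: vabs_mult)

lemma vabs_prod: "vabs (prod f A :: 'a::valued_field) = (\<Prod>i\<in>A. vabs (f i))"
  by (induction A rule: infinite_finite_induct) (auto simp: vabs_mult)

lemma vabs_divide: "vabs (u / v :: 'a::valued_field) = vabs u / vabs v"
proof (cases "v = 0")
  case False
  then have "vabs (u / v) * vabs v = vabs u"
    by (metis vabs_mult nonzero_divide_eq_eq)
  with False show ?thesis
    by (metis nonzero_eq_divide_eq vabs_eq_0)
qed simp

lemma vabs_diff_le_max: "vabs (u - v::'a::valued_field) \<le> max (vabs u) (vabs v)"
  using vabs_add_le_max[of u "- v"] by simp

lemma vabs_add_eq:
  assumes "vabs (u::'a::valued_field) < vabs v"
  shows "vabs (u + v) = vabs v"
  using vabs_add_le_max[of u v] vabs_diff_le_max[of "u + v" u] assms by (auto simp: max_def split: if_splits)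

lemma vabs_triangle: "vabs (u + v::'a::valued_field) \<le> vabs u + vabs v"
  using vabs_add_le_max[of u v] vabs_ge_0[of u] vabs_ge_0[of v] by linarith

lemma vabs_sum: "vabs (sum f A :: 'a::valued_field) \<le> (\<Sum>i\<in>A. vabs (f i))"
proof (induction A rule: infinite_finite_induct)
  case (insert i A)
  then show ?case
    using vabs_triangle[of "f i" "sum f A"] by simp
qed auto

instance valued_field \<subseteq> topological_ab_group_add
proof
  fix a b :: 'a
  show "((\<lambda>p. fst p + snd p) \<longlongrightarrow> a + b) (nhds a \<times>\<^sub>F nhds b)"
  proof (rule tendstoI)
    fix e :: real assume e: "e > 0"
    have "\<forall>\<^sub>F p in nhds a \<times>\<^sub>F nhds b. dist (fst p) a < e \<and> dist (snd p) b < e"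
      unfolding eventually_prod_filter
      using e by (intro exI[of _ "\<lambda>y. dist y a < e"] exI[of _ "\<lambda>y. dist y b < e"])
        (auto simp: eventually_nhds_metric)
    then show "\<forall>\<^sub>F p in nhds a \<times>\<^sub>F nhds b. dist (fst p + snd p) (a + b) < e"
    proof (rule eventually_mono)
      fix p :: "'a \<times> 'a" assume p: "dist (fst p) a < e \<and> dist (snd p) b < e"
      have "vabs ((fst p - a) + (snd p - b)) \<le> max (vabs (fst p - a)) (vabs (snd p - b))"
        by (rule vabs_add_le_max)
      with p show "dist (fst p + snd p) (a + b) < e"
        by (auto simp: dist_vabs algebra_simps)
    qed
  qed
  show "(uminus \<longlongrightarrow> - a) (nhds a)"
  proof (rule tendstoI)
    fix e :: real assume e: "e > 0"
    have "dist (- y) (- a) = dist y a" for y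
      by (metis dist_vabs vabs_minus minus_diff_eq minus_diff_minus)
    then show "\<forall>\<^sub>F y in nhds a. dist (- y) (- a) < e"
      using e by (auto simp: eventually_nhds_metric)
  qed
qed

lemma vsummable_geometric:
  fixes f :: "nat \<Rightarrow> 'a::{valued_field,complete_space}"
  assumes "\<And>m. vabs (f m) \<le> (1/2) ^ m"
  shows "summable f"
proof -
  have bound: "vabs (sum f {m..<n}) \<le> 2 * (1/2) ^ m" if "m \<le> n" for m n
  proof -
    have "vabs (sum f {m..<n}) \<le> (\<Sum>i=m..<n. (1/2) ^ i)"
      using vabs_sum[of f "{m..<n}"] sum_mono[of "{m..<n}" "\<lambda>i. vabs (f i)" "\<lambda>i. (1/2) ^ i"] assms
      by (meson order_trans)
    also have "\<dots> = 2 * (1/2) ^ m - 2 * (1/2) ^ n"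
      using that by (induction n rule: dec_induct) auto
    finally show ?thesis by (smt (verit) zero_le_power half_gt_zero)
  qed
  have "Cauchy (\<lambda>n. sum f {..<n})"
  proof (rule metric_CauchyI)
    fix e :: real assume "e > 0"
    then obtain M where M: "(1/2) ^ M < e / 2"
      using real_arch_pow_inv[of "e/2" "1/2"] by auto
    have *: "dist (sum f {..<n}) (sum f {..<m}) < e" if "M \<le> m" "m \<le> n" for m n
    proof -
      have "dist (sum f {..<n}) (sum f {..<m}) = vabs (sum f {m..<n})"
        using that by (simp add: dist_vabs flip: sum_diff_nat_ivl[of 0 m n] lessThan_atLeast0)
      also have "\<dots> \<le> 2 * (1/2) ^ m" using bound that by simp
      also have "\<dots> \<le> 2 * (1/2) ^ M" using that by (simp add: power_decreasing)
      finally show ?thesis using M by simp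
    qed
    have "\<forall>m\<ge>M. \<forall>n\<ge>M. dist (sum f {..<m}) (sum f {..<n}) < e"
      by (metis * dist_commute nat_le_linear)
    then show "\<exists>M. \<forall>m\<ge>M. \<forall>n\<ge>M. dist (sum f {..<m}) (sum f {..<n}) < e" ..
  qed
  then show ?thesis
    by (simp add: Cauchy_convergent_iff summable_iff_convergent)
qed

lemma q_ge_2: "CARD('k::{field,finite}) \<ge> 2"
  using card_mono[of "UNIV :: 'k set" "{0, 1}"] by simp

lemma sum_power_lessThan_le: "2 \<le> q \<Longrightarrow> (\<Sum>i<m. q ^ i) \<le> (q::nat) ^ m"
proof (induction m)
  case (Suc m)
  have "q ^ m + q ^ m \<le> q * q ^ m" using mult_le_mono1[OF Suc.prems, of "q ^ m"] by (simp only: mult_2)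
  with Suc show ?case by simp
qed simp

lemma sum_power_diff_le: "2 \<le> q \<Longrightarrow> (\<Sum>i<m. q ^ (m - i)) \<le> 2 * (q::nat) ^ m"
proof -
  assume q: "2 \<le> q"
  have "(\<Sum>i<m. q ^ (m - i)) = (\<Sum>i<m. q ^ Suc i)"
    by (rule sum.reindex_bij_witness[of _ "\<lambda>i. m - Suc i" "\<lambda>i. m - Suc i"]) (auto simp: Suc_diff_Suc simp flip: power_Suc)
  also have "\<dots> \<le> (\<Sum>i<Suc m. q ^ i)"
    by (subst sum.lessThan_Suc_shift) simp
  also have "\<dots> \<le> 2 * q ^ m"
    using sum_power_lessThan_le[OF q, of m] by simp
  finally show ?thesis .
qed

context
  fixes q :: nat and x :: "'c::{valued_field,complete_space}"
  assumes q2: "2 \<le> q" and nx: "0 < vabs x" "vabs x < 1"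
begin

lemma vabs_x_power: "vabs (x ^ (q ^ k)) \<le> vabs x ^ k"
proof -
  have "k \<le> q ^ k"
    using q2 by (metis less_exp order_less_imp_le power_mono order_trans zero_le)
  then show ?thesis
    using nx by (simp add: vabs_power power_decreasing)
qed

lemma vabs_bracket:
  assumes "k \<ge> 1" shows "vabs (bracket q x k) = vabs x"
proof -
  have "2 \<le> q ^ k"
    using q2 assms self_le_power[of q k] by simp
  then have "vabs x ^ (q ^ k) \<le> vabs x ^ 2"
    using nx by (intro power_decreasing) auto
  also have "\<dots> < vabs x"
    using nx by (simp add: power2_eq_square)
  finally have "vabs (x ^ (q ^ k)) < vabs (- x)"
    by (simp add: vabs_power)
  from vabs_add_eq[OF this] show ?thesis
    by (simp add: bracket_def)
qed

lemma vabs_poch_le: "vabs (poch q x a m) \<le> ((max 1 (vabs a)) ^ 2) ^ (q ^ m)"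
proof -
  let ?M = "max 1 (vabs a)"
  have "vabs (bracket q x i) \<le> 1" for i
    using vabs_bracket[of i] nx by (cases i) (auto simp: bracket_def)
  then have b: "vabs (bracket q x i - a) \<le> ?M" for i
    using vabs_diff_le_max[of "bracket q x i" a] by (smt (verit) max_def)
  have "vabs (poch q x a m) = (\<Prod>i<m. vabs (bracket q x i - a) ^ (q ^ (m - i)))"
    by (simp add: poch_def vabs_prod vabs_power)
  also have "\<dots> \<le> (\<Prod>i<m. ?M ^ (q ^ (m - i)))"
    by (intro prod_mono conjI power_mono b) auto
  also have "\<dots> = ?M ^ (\<Sum>i<m. q ^ (m - i))"
    by (simp add: power_sum)
  also have "\<dots> \<le> ?M ^ (2 * q ^ m)"
    using sum_power_diff_le[OF q2] by (intro power_increasing) auto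
  finally show ?thesis by (simp add: power_mult)
qed

lemma vabs_carlitz_D_ge: "vabs x ^ (q ^ m) \<le> vabs (carlitz_D q x m)"
proof -
  have "vabs (carlitz_D q x m) = (\<Prod>i<m. vabs x ^ (q ^ i))"
    unfolding carlitz_D_def vabs_prod
    by (intro prod.cong) (auto simp: vabs_power vabs_bracket)
  also have "\<dots> = vabs x ^ (\<Sum>i<m. q ^ i)"
    by (simp add: power_sum)
  also have "\<dots> \<ge> vabs x ^ (q ^ m)"
    using sum_power_lessThan_le[OF q2] nx by (intro power_decreasing) auto
  finally show ?thesis .
qed

lemma admissible_bracket_bound:
  assumes "admissible q x c"
  obtains d where "0 < d" "d \<le> 1" "\<And>i. d \<le> vabs (bracket q x i - c)"
proof -
  have cx: "vabs (- x - c) > 0"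
    using assms vabs_eq_0[of "- x - c"] vabs_ge_0[of "- x - c"]
    by (auto simp: admissible_def bracket_inf_def less_le simp del: vabs_eq_0 vabs_ge_0)
  then obtain N where N: "vabs x ^ N < vabs (- x - c)"
    using nx real_arch_pow_inv[of "vabs (- x - c)" "vabs x"] by auto
  have large: "vabs (bracket q x i - c) = vabs (- x - c)" if "i \<ge> N" for i
  proof -
    have "vabs (x ^ (q ^ i)) < vabs (- x - c)"
      using vabs_x_power[of i] power_decreasing[OF that, of "vabs x"] nx N by linarith
    from vabs_add_eq[OF this] show ?thesis
      by (simp add: bracket_def algebra_simps)
  qed
  define S where "S = insert 1 (insert (vabs (- x - c)) ((\<lambda>i. vabs (bracket q x i - c)) ` {..<N}))"
  have pos: "0 < vabs (bracket q x i - c)" for i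
    using assms by (simp add: admissible_def less_le) metis
  have "finite S" "S \<noteq> {}" by (auto simp: S_def)
  moreover have "\<And>s. s \<in> S \<Longrightarrow> 0 < s"
    using cx pos by (auto simp: S_def)
  ultimately have "0 < Min S" by (simp add: Min_gr_iff)
  moreover have "Min S \<le> 1"
    using \<open>finite S\<close> by (intro Min_le) (auto simp: S_def)
  moreover have "Min S \<le> vabs (bracket q x i - c)" for i
  proof (rule Min_le[OF \<open>finite S\<close>])
    show "vabs (bracket q x i - c) \<in> S"
      using large[of i] by (cases "i < N") (auto simp: S_def)
  qed
  ultimately show thesis by (rule that)
qed

lemma vabs_poch_ge:
  assumes "0 < d" "d \<le> 1" "\<And>i. d \<le> vabs (bracket q x i - c)"
  shows "(d ^ 2) ^ (q ^ m) \<le> vabs (poch q x c m)"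
proof -
  have "(d ^ 2) ^ (q ^ m) = d ^ (2 * q ^ m)" by (simp add: power_mult)
  also have "\<dots> \<le> d ^ (\<Sum>i<m. q ^ (m - i))"
    using sum_power_diff_le[OF q2] assms by (intro power_decreasing) auto
  also have "\<dots> = (\<Prod>i<m. d ^ (q ^ (m - i)))"
    by (simp add: power_sum)
  also have "\<dots> \<le> (\<Prod>i<m. vabs (bracket q x i - c) ^ (q ^ (m - i)))"
    using assms by (intro prod_mono conjI power_mono) auto
  finally show ?thesis
    by (simp add: poch_def vabs_prod vabs_power)
qed

lemma hyp2F1_summable_aux:
  assumes "admissible q x c"
  shows "\<forall>\<^sub>F z in nhds 0. summable (hyp_term q x a b c z)"
proof -
  obtain d where d: "0 < d" "d \<le> 1" "\<And>i. d \<le> vabs (bracket q x i - c)"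
    using admissible_bracket_bound[OF assms] by blast
  define A where "A = (max 1 (vabs a)) ^ 2"
  define B where "B = (max 1 (vabs b)) ^ 2"
  define R where "R = A * B / d ^ 2 / vabs x"
  have A: "A > 0" "B > 0" by (auto simp: A_def B_def intro!: zero_less_power)
  have R: "R > 0" using A d nx by (simp add: R_def)
  have "summable (hyp_term q x a b c z)" if z: "vabs z < 1 / (2 * R)" for z
  proof (rule vsummable_geometric)
    fix m
    have "vabs (hyp_term q x a b c z m) =
        vabs (poch q x a m) * vabs (poch q x b m) / vabs (poch q x c m) *
        (vabs z ^ (q ^ m) / vabs (carlitz_D q x m))"
      by (simp add: hyp_term_def vabs_mult vabs_divide vabs_power)
    also have "\<dots> \<le> A ^ (q ^ m) * B ^ (q ^ m) / (d ^ 2) ^ (q ^ m) * (vabs z ^ (q ^ m) / vabs x ^ (q ^ m))"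
      using vabs_poch_le[of a m] vabs_poch_le[of b m] vabs_poch_ge[OF d] vabs_carlitz_D_ge[of m] d nx A
      unfolding A_def[symmetric] B_def[symmetric]
      by (intro mult_mono frac_le divide_nonneg_nonneg mult_nonneg_nonneg zero_le_power) auto
    also have "\<dots> = (R * vabs z) ^ (q ^ m)"
      by (simp add: R_def power_mult_distrib power_divide)
    also have "\<dots> \<le> (1/2) ^ (q ^ m)"
      using z R by (intro power_mono) (auto simp: field_simps)
    also have "\<dots> \<le> (1/2) ^ m"
    proof (rule power_decreasing)
      show "m \<le> q ^ m"
        using q2 by (metis less_exp order_less_imp_le power_mono order_trans zero_le)
    qed auto
    finally show "vabs (hyp_term q x a b c z m) \<le> (1/2) ^ m" .
  qed
  then show ?thesis
    using R by (auto simp: eventually_nhds_metric dist_vabs intro!: exI[of _ "1 / (2 * R)"])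
qed

end

lemma hyp2F1_summable:
  fixes \<iota> :: "'k::{field,finite} fls alg_closure \<Rightarrow> 'c::{valued_field,complete_space}"
  assumes "completed_alg_closure \<iota>" and q: "q = CARD('k)" and x: "x = \<iota> (to_ac fls_X)"
    and "admissible q x c"
  shows "\<forall>\<^sub>F z in nhds 0. summable (hyp_term q x a b c z)"
proof (rule hyp2F1_summable_aux)
  show q2: "2 \<le> q" using q q_ge_2 by simp
  have "vabs x = laurent_abs (fls_X :: 'k fls)"
    using assms by (simp add: completed_alg_closure_def)
  then have "vabs x = 1 / real q"
    by (simp add: laurent_abs_def q power_int_minus divide_inverse)
  then show "0 < vabs x" "vabs x < 1"
    using q2 by auto
qed fact

end

theory Submission
  imports Defs "HOL-Algebra.Sylow"
begin

text \<open>
  Raising to the power $q$ is additive and, since the algebraic closure has $q$-th roots and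
  Frobenius only rescales distances, bijective on the completion. From
  $[k+1] = [k]^q + [1]$ one gets $([k] - T_1(a))^q = [k+1] - a$, so the products defining
  $\langle a\rangle$ and $\langle T_1(a)\rangle$ differ by a shift of the index; this yields
  (i)--(iv), where $T_{-1}$ is handled as the inverse of $T_1$. The contiguous relations (v), (vi)
  then hold coefficientwise: in (v) because $a^{q^m}\langle T_1(a)\rangle_m = (a - [m])\langle a\rangle_m$
  without any assumption on $a$, and in (vi) because, with $k = a^q + [1]$, the coefficients at
  $z^{q^{m+1}}$ are linked by $([m] - a)^q + k = [m+1]$ and $([m]-b)^q - ([m]-c)^q = c^q - b^q$.
\<close>

section \<open>The Frobenius map of the completed algebraic closure\<close>

text \<open>A prime \<open>r\<close> dividing the order of the additive group yields, by Sylow's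
  theorem, a subgroup of order \<open>r\<close>. A nonzero element of it is killed by
  \<open>r\<close>, so the characteristic divides \<open>r\<close> and hence equals it.\<close>

lemma CARD_finite_field_prime_power:
  obtains n where "CARD('k::{field,finite}) = CHAR('k) ^ n" "Factorial_Ring.prime CHAR('k)"
proof -
  let ?p = "CHAR('k)" and ?q = "CARD('k)"
  have p: "Factorial_Ring.prime ?p"
    by (rule prime_CHAR_semidom, rule finite_imp_CHAR_pos) simp
  have unique: "r = ?p" if r: "Factorial_Ring.prime r" "r dvd ?q" for r
  proof -
    define G where "G = \<lparr>carrier = (UNIV :: 'k set), monoid.mult = (+), one = (0 :: 'k)\<rparr>"
    interpret group G
    proof (rule groupI)
      fix u assume "u \<in> carrier G"
      show "\<exists>v\<in>carrier G. v \<otimes>\<^bsub>G\<^esub> u = \<one>\<^bsub>G\<^esub>"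
        by (intro bexI[of _ "- u"]) (auto simp: G_def)
    qed (auto simp: G_def add_ac)
    have "\<exists>H. subgroup H G \<and> card H = r ^ 1"
      by (rule sylow_thm[of _ _ _ "?q div r"]) (use r is_group in \<open>auto simp: G_def Coset.order_def\<close>)
    then obtain H where H: "subgroup H G" "card H = r" by auto
    interpret H: group "G\<lparr>carrier := H\<rparr>"
      by (rule subgroup.subgroup_is_group[OF H(1) is_group])
    have "\<not> H \<subseteq> {0}"
      using card_mono[of "{0::'k}" H] H r prime_ge_2_nat[of r] by auto
    then obtain u where u: "u \<in> H" "u \<noteq> 0" by auto
    have pow: "u [^]\<^bsub>G\<lparr>carrier := H\<rparr>\<^esub> (n::nat) = of_nat n * u" for n
      by (induction n) (auto simp: G_def algebra_simps)
    have "u [^]\<^bsub>G\<lparr>carrier := H\<rparr>\<^esub> Coset.order (G\<lparr>carrier := H\<rparr>) = \<one>\<^bsub>G\<lparr>carrier := H\<rparr>\<^esub>"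
      by (rule H.pow_order_eq_1) (use u in auto)
    then have "of_nat r * u = 0"
      unfolding pow by (simp add: Coset.order_def H G_def)
    then have "?p dvd r"
      using u by (simp add: of_nat_eq_0_iff_char_dvd)
    with r p show "r = ?p"
      using primes_dvd_imp_eq by blast
  qed
  \<comment> \<open>Split off the full power of \<open>?p\<close>; a prime factor of the cofactor
    \<open>m\<close> would be \<open>?p\<close> again.\<close>
  obtain m where m: "?q = ?p ^ multiplicity ?p ?q * m" "\<not> ?p dvd m"
    using multiplicity_decompose'[of ?q ?p] p by (metis not_prime_unit zero_less_card_finite neq0_conv)
  have "m = 1"
  proof (rule ccontr)
    assume "m \<noteq> 1"
    then obtain r where "Factorial_Ring.prime r" "r dvd m"
      using prime_factor_nat by blast
    with unique[of r] m show False
      by (metis dvd_mult)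
  qed
  with m(1) p that show thesis by simp
qed

text \<open>The embedding preserves numerals, so the characteristic of the completion divides the
  prime \<open>CHAR('k)\<close>; as it is not 1, the two agree and the freshman's dream
  applies.\<close>

lemma completed_alg_closure_power_add:
  fixes \<iota> :: "'k::{field,finite} fls alg_closure \<Rightarrow> 'c::{valued_field,complete_space}"
  assumes "completed_alg_closure \<iota>"
  shows "(u + v :: 'c) ^ CARD('k) = u ^ CARD('k) + v ^ CARD('k)"
proof -
  obtain n where n: "CARD('k) = CHAR('k) ^ n" "Factorial_Ring.prime CHAR('k)"
    by (rule CARD_finite_field_prime_power)
  have hom: "\<iota> 1 = 1" "\<And>u v. \<iota> (u + v) = \<iota> u + \<iota> v"
    using assms by (auto simp: completed_alg_closure_def)
  have \<iota>0: "\<iota> 0 = 0" using hom(2)[of 0 0] by (metis add_cancel_left_left add_0)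
  have "\<iota> (of_nat m) = of_nat m" for m
    by (induction m) (simp_all add: hom \<iota>0)
  then have "of_nat CHAR('k) = (0::'c)"
    by (metis \<iota>0 of_nat_CHAR CHAR_alg_closure semiring_char_fls)
  then have "CHAR('c) dvd CHAR('k)"
    by (simp add: of_nat_eq_0_iff_char_dvd)
  then have "CHAR('c) = CHAR('k)"
    using n(2) by (metis CHAR_not_1' One_nat_def prime_nat_iff)
  then show ?thesis
    using freshmans_dream'[where 'a = 'c, of "CARD('k)" n] n by simp
qed

lemma power_diff_of_additive:
  fixes u v :: "'a::comm_ring_1"
  assumes "\<And>u v :: 'a. (u + v) ^ q = u ^ q + v ^ q"
  shows "(u - v) ^ q = u ^ q - v ^ q"
  using assms[of "u - v" v] by (simp add: algebra_simps)

text \<open>This exact scaling gives both the continuity of the power map and the Cauchy property of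
  sequences of roots.\<close>

lemma dist_power_of_additive:
  fixes u v :: "'c::valued_field"
  assumes "\<And>u v :: 'c. (u + v) ^ q = u ^ q + v ^ q"
  shows "dist (u ^ q) (v ^ q) = dist u v ^ q"
  by (simp add: dist_vabs vabs_power flip: power_diff_of_additive[OF assms])

lemma tendsto_power_of_additive:
  fixes f :: "nat \<Rightarrow> 'c::valued_field"
  assumes "\<And>u v :: 'c. (u + v) ^ q = u ^ q + v ^ q" and "0 < q" and "f \<longlonglongrightarrow> l"
  shows "(\<lambda>n. f n ^ q) \<longlonglongrightarrow> l ^ q"
proof -
  have "(\<lambda>n. dist (f n) l) \<longlonglongrightarrow> 0"
    using assms(3) tendsto_dist_iff by blast
  then have "(\<lambda>n. dist (f n) l ^ q) \<longlonglongrightarrow> 0 ^ q"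
    by (rule tendsto_power)
  then have "(\<lambda>n. dist (f n ^ q) (l ^ q)) \<longlonglongrightarrow> 0"
    using assms(2) by (simp only: dist_power_of_additive[OF assms(1)] zero_power)
  then show ?thesis
    by (subst tendsto_dist_iff)
qed

text \<open>The dense image contains the roots of its elements. Roots of a sequence tending to
  \<open>y\<close> form a Cauchy sequence, and continuity makes its limit a root of
  \<open>y\<close>.\<close>

lemma completed_alg_closure_root_exists:
  fixes \<iota> :: "'k::{field,finite} fls alg_closure \<Rightarrow> 'c::{valued_field,complete_space}" and y :: 'c
  assumes "completed_alg_closure \<iota>"
  shows "\<exists>w. w ^ CARD('k) = y"
proof -
  let ?q = "CARD('k)"
  note add = completed_alg_closure_power_add[OF assms]
  have q: "0 < ?q" by simp
  have hom: "\<iota> 1 = 1" "\<And>u v. \<iota> (u * v) = \<iota> u * \<iota> v"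
    using assms by (auto simp: completed_alg_closure_def)
  have \<iota>_power: "\<iota> (u ^ n) = \<iota> u ^ n" for u n
    by (induction n) (simp_all add: hom)
  have "y \<in> closure (range \<iota>)"
    using assms by (auto simp: completed_alg_closure_def)
  then obtain s where s: "\<And>n. s n \<in> range \<iota>" "s \<longlonglongrightarrow> y"
    using closure_sequential by blast
  have "\<exists>w. w ^ ?q = s n" for n
  proof -
    obtain u where u: "s n = \<iota> u" using s(1)[of n] by auto
    obtain v where "v ^ ?q = u" using nth_root_exists[OF q] by blast
    with u show ?thesis by (metis \<iota>_power)
  qed
  then obtain w where w: "\<And>n. w n ^ ?q = s n" by metis
  have "Cauchy s"
    using s(2) by (rule LIMSEQ_imp_Cauchy)
  have "Cauchy w"
  proof (rule metric_CauchyI)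
    fix e :: real assume e: "0 < e"
    \<comment> \<open>The tolerance is \<open>e ^ ?q\<close> because passing to roots turns
      distances into their \<open>?q\<close>-th roots.\<close>
    then obtain M where M: "\<And>m n. m \<ge> M \<Longrightarrow> n \<ge> M \<Longrightarrow> dist (s m) (s n) < e ^ ?q"
      using metric_CauchyD[OF \<open>Cauchy s\<close>, of "e ^ ?q"] by auto
    have "dist (w m) (w n) < e" if "m \<ge> M" "n \<ge> M" for m n
    proof -
      have "dist (w m) (w n) ^ ?q < e ^ ?q"
        using M[OF that] by (simp add: w flip: dist_power_of_additive[OF add])
      then show ?thesis
        using e by (simp add: power_less_imp_less_base)
    qed
    then show "\<exists>M. \<forall>m\<ge>M. \<forall>n\<ge>M. dist (w m) (w n) < e" by blast
  qed
  then obtain l where "w \<longlonglongrightarrow> l"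
    using Cauchy_convergent convergent_def by blast
  then have "s \<longlonglongrightarrow> l ^ ?q"
    using tendsto_power_of_additive[OF add q, of w l] by (simp add: w)
  with s(2) show ?thesis
    using LIMSEQ_unique by blast
qed

section \<open>Pochhammer symbols under the shifts\<close>

text \<open>Isolates the algebra from the topology. Injectivity of the power map follows from
  additivity, as a field has no nilpotents.\<close>

locale frobenius_field =
  fixes q :: nat and x :: "'c::field"
  assumes q_ge_2: "2 \<le> q"
    and power_q_add: "\<And>u v :: 'c. (u + v) ^ q = u ^ q + v ^ q"
    and power_q_root: "\<And>y :: 'c. \<exists>w. w ^ q = y"
begin

lemma q_pos: "0 < q"
  using q_ge_2 by simp

lemmas power_q_diff = power_diff_of_additive[OF power_q_add]

lemma power_q_minus: "(- u :: 'c) ^ q = - (u ^ q)"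
  using power_q_diff[of 0 u] q_pos by simp

lemma power_q_inject: "(u :: 'c) ^ q = v ^ q \<Longrightarrow> u = v"
  using power_q_diff[of u v] by simp

lemma qroot_power: "qroot q (y :: 'c) ^ q = y"
proof -
  have "\<exists>!w. w ^ q = y"
    using power_q_root[of y] power_q_inject by blast
  then show ?thesis
    unfolding qroot_def by (rule theI')
qed

lemma T_pos_power: "T_pos q x a ^ q = a - bracket q x 1"
  by (simp add: T_pos_def qroot_power)

lemma T_pos_T_neg: "T_pos q x (T_neg q x a) = a"
  by (rule power_q_inject) (simp add: T_pos_power T_neg_def)

lemma bracket_0: "bracket q x 0 = 0"
  by (simp add: bracket_def)

lemma bracket_Suc: "bracket q x (Suc k) = bracket q x k ^ q + bracket q x 1"
  by (simp add: bracket_def power_q_diff mult.commute flip: power_mult)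

lemma bracket_diff_T_pos_power: "(bracket q x k - T_pos q x a) ^ q = bracket q x (Suc k) - a"
  by (simp add: power_q_diff T_pos_power bracket_Suc del: One_nat_def)

lemma power_q_power_Suc: "((u::'c) ^ (q ^ m)) ^ q = u ^ (q ^ Suc m)"
  by (simp add: mult.commute flip: power_mult)

lemma poch_0: "poch q x a 0 = 1"
  by (simp add: poch_def)

text \<open>Each old exponent \<open>q ^ (m - i)\<close> gains a factor \<open>q\<close> and the new
  factor enters with exponent \<open>q\<close>, so the whole product is a \<open>q\<close>-th
  power.\<close>

lemma poch_Suc: "poch q x a (Suc m) = (poch q x a m * (bracket q x m - a)) ^ q"
proof -
  have "(\<Prod>i<m. (bracket q x i - a) ^ q ^ (Suc m - i)) = (\<Prod>i<m. ((bracket q x i - a) ^ q ^ (m - i)) ^ q)"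
    by (intro prod.cong) (auto simp: power_q_power_Suc Suc_diff_le simp del: power_Suc)
  then show ?thesis
    by (simp add: poch_def power_mult_distrib prod_power_distrib)
qed

text \<open>The factor at index 0 is a power of \<open>- a\<close>; the remaining ones are the
  \<open>q\<close>-th powers of the factors for \<open>T_pos q x a\<close>, moved up by one
  index.\<close>

lemma poch_Suc_T_pos:
  "poch q x a (Suc m) = - (a ^ (q ^ Suc m)) * poch q x (T_pos q x a) m ^ q"
proof (induction m)
  case 0
  show ?case by (simp add: poch_Suc poch_0 bracket_0 power_q_minus)
next
  case (Suc m)
  have "poch q x a (Suc (Suc m)) =
      (- (a ^ (q ^ Suc m)) * poch q x (T_pos q x a) m ^ q * (bracket q x (Suc m) - a)) ^ q"
    by (subst poch_Suc) (simp only: Suc.IH)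
  also have "\<dots> = - (a ^ (q ^ Suc (Suc m))) * poch q x (T_pos q x a) (Suc m) ^ q"
    by (simp only: poch_Suc[of _ m] power_mult_distrib bracket_diff_T_pos_power power_q_minus
        power_q_power_Suc mult.assoc)
  finally show ?case .
qed

text \<open>Free of division, so that \<open>a = 0\<close> is covered; \<open>m = 0\<close> is
  included because the series starts there.\<close>

lemma poch_T_pos:
  "a ^ (q ^ m) * poch q x (T_pos q x a) m = (a - bracket q x m) * poch q x a m"
proof (cases m)
  case 0
  then show ?thesis by (simp add: poch_0 bracket_0)
next
  case (Suc k)
  have "poch q x (T_pos q x a) (Suc k) = poch q x (T_pos q x a) k ^ q * (bracket q x (Suc k) - a)"
    by (simp only: poch_Suc power_mult_distrib bracket_diff_T_pos_power)
  then show ?thesis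
    by (simp only: Suc poch_Suc_T_pos[of a k]) (simp add: algebra_simps del: power_Suc)
qed

lemma poch_Suc_T_neg:
  "poch q x (T_neg q x a) (Suc m) = - ((a ^ q + bracket q x 1) ^ (q ^ Suc m)) * poch q x a m ^ q"
  unfolding poch_Suc_T_pos T_pos_T_neg by (simp only: T_neg_def)

lemma poch_nonzero:
  assumes "admissible q x c"
  shows "poch q x c m \<noteq> 0"
  using assms by (auto simp: poch_def admissible_def)

lemma carlitz_D_Suc: "carlitz_D q x (Suc m) = bracket q x (Suc m) * carlitz_D q x m ^ q"
  by (simp add: carlitz_D_def prod.lessThan_Suc_shift prod_power_distrib power_q_power_Suc
      del: prod.lessThan_Suc power_Suc)

text \<open>Makes the series with lower parameter \<open>T_pos q x c\<close> converge. The map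
  \<open>T_neg\<close> sends each bracket to the next one and fixes \<open>- x\<close>, so an
  excluded value of \<open>T_pos q x c\<close> would force one of \<open>c\<close>.\<close>

lemma admissible_T_pos:
  assumes "admissible q x c"
  shows "admissible q x (T_pos q x c)"
proof -
  have c: "c = T_pos q x c ^ q + bracket q x 1"
    by (simp add: T_pos_power)
  have "T_pos q x c \<noteq> bracket q x k" for k
    using assms c bracket_Suc[of k] unfolding admissible_def by metis
  moreover have "T_pos q x c \<noteq> bracket_inf x"
    using assms c by (auto simp: admissible_def bracket_inf_def bracket_def power_q_minus)
  ultimately show ?thesis
    by (auto simp: admissible_def)
qed

end

section \<open>Contiguous relations\<close>

lemma tendsto_vmult_left:
  fixes f :: "'b \<Rightarrow> 'c::valued_field"
  assumes "(f \<longlongrightarrow> l) F"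
  shows "((\<lambda>y. k * f y) \<longlongrightarrow> k * l) F"
proof -
  have "((\<lambda>y. dist (f y) l) \<longlongrightarrow> 0) F"
    using assms tendsto_dist_iff by blast
  then have "((\<lambda>y. vabs k * dist (f y) l) \<longlongrightarrow> vabs k * 0) F"
    by (intro tendsto_mult tendsto_const)
  then show ?thesis
    by (subst tendsto_dist_iff) (simp add: dist_vabs flip: vabs_mult right_diff_distrib)
qed

lemma vsums_mult:
  fixes f :: "nat \<Rightarrow> 'c::valued_field"
  shows "f sums s \<Longrightarrow> (\<lambda>n. k * f n) sums (k * s)"
  unfolding sums_def by (simp add: tendsto_vmult_left flip: sum_distrib_left)

lemma vsums_diff:
  fixes f g :: "nat \<Rightarrow> 'c::valued_field"
  assumes "f sums s" "g sums t"
  shows "(\<lambda>n. f n - g n) sums (s - t)"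
  using sums_add[OF assms(1) vsums_mult[OF assms(2), of "- 1"]] by simp

text \<open>Multiplication by \<open>k\<close> is continuous and fixes 0. This pulls a neighbourhood
  of convergence back from the rescaled argument to \<open>z\<close>, also for
  \<open>k = 0\<close>.\<close>

lemma eventually_nhds_0_vmult:
  fixes k :: "'c::valued_field"
  assumes "\<forall>\<^sub>F z in nhds 0. P z"
  shows "\<forall>\<^sub>F z in nhds 0. P (k * z)"
proof -
  have "((\<lambda>z. k * z) \<longlongrightarrow> k * 0) (nhds 0)"
    by (rule tendsto_vmult_left) (rule filterlim_ident)
  then have "filterlim (\<lambda>z. k * z) (nhds 0) (nhds 0)" by simp
  from filterlim_iff[THEN iffD1, OF this] assms show ?thesis by blast
qed

locale valued_frobenius_field = frobenius_field q x
  for q :: nat and x :: "'c::{valued_field,complete_space}" +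
  assumes vabs_x: "0 < vabs x" "vabs x < 1"
begin

text \<open>Additivity moves the power inside the partial sums, continuity moves it past the
  limit.\<close>

lemma power_q_sums:
  fixes f :: "nat \<Rightarrow> 'c"
  assumes "f sums s"
  shows "(\<lambda>n. f n ^ q) sums (s ^ q)"
proof -
  have "(\<Sum>i<n. f i ^ q) = (\<Sum>i<n. f i) ^ q" for n
    by (induction n) (use q_pos in \<open>simp_all add: power_q_add\<close>)
  then show ?thesis
    using tendsto_power_of_additive[OF power_q_add q_pos] assms unfolding sums_def by simp
qed

lemma eventually_hyp_term_sums:
  assumes "admissible q x c"
  shows "\<forall>\<^sub>F z in nhds 0. hyp_term q x a b c (k * z) sums hyp2F1 q x a b c (k * z)"
  using eventually_nhds_0_vmult[OF hyp2F1_summable_aux[OF q_ge_2 vabs_x assms, of a b], of k]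
  by eventually_elim (simp add: hyp2F1_def summable_sums)

lemma bracket_Suc_nonzero: "bracket q x (Suc m) \<noteq> 0"
  using vabs_bracket[OF q_ge_2 vabs_x, of "Suc m"] vabs_x by auto

lemma carlitz_D_nonzero: "carlitz_D q x m \<noteq> 0"
  by (induction m) (auto simp: carlitz_D_Suc bracket_Suc_nonzero, simp add: carlitz_D_def)

text \<open>Rescaling the argument supplies exactly the power of \<open>a\<close> on the left of
  \<open>poch_T_pos\<close>.\<close>

lemma hyp_term_T_pos:
  "hyp_term q x (T_pos q x a) b c (a * z) m = (a - bracket q x m) * hyp_term q x a b c z m"
proof -
  have "hyp_term q x (T_pos q x a) b c (a * z) m =
      (a ^ (q ^ m) * poch q x (T_pos q x a) m) * poch q x b m / poch q x c m *
        (z ^ (q ^ m) / carlitz_D q x m)"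
    by (simp add: hyp_term_def power_mult_distrib)
  then show ?thesis
    unfolding poch_T_pos by (simp add: hyp_term_def)
qed

lemma hyp_term_commute: "hyp_term q x a b c z m = hyp_term q x b a c z m"
  by (simp add: hyp_term_def mult.commute)

text \<open>The two shifts multiply the \<open>m\<close>-th term by \<open>a - bracket q x m\<close>
  and \<open>b - bracket q x m\<close>; the difference of these factors does not depend on
  \<open>m\<close>.\<close>

lemma hyp2F1_T_pos_contiguous:
  assumes "admissible q x c"
  shows "\<forall>\<^sub>F z in nhds 0.
    hyp2F1 q x (T_pos q x a) b c (a * z) - hyp2F1 q x a (T_pos q x b) c (b * z) =
      (a - b) * hyp2F1 q x a b c z"
  using eventually_hyp_term_sums[OF assms, of "T_pos q x a" b a]
    eventually_hyp_term_sums[OF assms, of a "T_pos q x b" b]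
    eventually_hyp_term_sums[OF assms, of a b 1]
proof eventually_elim
  case (elim z)
  have "hyp_term q x (T_pos q x a) b c (a * z) m - hyp_term q x a (T_pos q x b) c (b * z) m =
      (a - b) * hyp_term q x a b c z m" for m
    by (simp add: hyp_term_T_pos hyp_term_commute[of a "T_pos q x b"] hyp_term_commute[of b a]
        flip: left_diff_distrib)
  with vsums_diff[OF elim(1,2)] vsums_mult[OF elim(3), of "a - b"] show ?case
    by (simp add: sums_unique2)
qed

text \<open>Indices \<open>Suc m\<close> and \<open>m\<close> are paired because the
  \<open>q\<close>-th power of the \<open>m\<close>-th term carries the exponent
  \<open>q ^ Suc m\<close> of \<open>z\<close>.\<close>

lemma hyp_term_coefficient_relation:
  assumes c: "admissible q x c" and k: "k = a ^ q + bracket q x 1" "k \<noteq> 0"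
  shows "hyp_term q x a b c z (Suc m) - hyp_term q x a b c z m ^ q
      + (c ^ q - b ^ q) * hyp_term q x a b (T_pos q x c) (inverse c * z) m ^ q
      - k * hyp_term q x (T_neg q x a) b c (inverse k * z) (Suc m) = 0"
proof -
  define A B C E D where defs: "A = poch q x a m ^ q" "B = poch q x b m ^ q" "C = poch q x c m ^ q"
    "E = poch q x (T_pos q x c) m ^ q" "D = carlitz_D q x m ^ q"
  define n Q Z where defs': "n = bracket q x (Suc m)" "Q = q ^ Suc m" "Z = z ^ (q ^ Suc m)"
  define \<alpha> \<beta> \<gamma> where greek: "\<alpha> = (bracket q x m - a) ^ q" "\<beta> = (bracket q x m - b) ^ q"
    "\<gamma> = (bracket q x m - c) ^ q"
  have nonzero: "C \<noteq> 0" "\<gamma> \<noteq> 0" "n \<noteq> 0" "D \<noteq> 0" "c \<noteq> 0"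
    using poch_nonzero[OF c] c bracket_Suc_nonzero carlitz_D_nonzero
    by (auto simp: defs defs' greek admissible_def) (metis bracket_0)+
  have \<alpha>: "\<alpha> = n - k" and e: "c ^ q - b ^ q = \<beta> - \<gamma>"
    by (simp_all add: greek defs' k bracket_Suc[of m] power_q_diff del: One_nat_def)
  \<comment> \<open>Both sides equal \<open>poch q x c (Suc m)\<close>. This trades \<open>E\<close>
    for \<open>C * \<gamma>\<close>, and \<open>c ^ Q\<close> cancels against the rescaled
    argument.\<close>
  have CE: "C * \<gamma> = - (c ^ Q) * E"
    unfolding defs defs' greek using poch_Suc_T_pos[of c m] poch_Suc[of c m]
    by (simp add: power_mult_distrib)
  have t1: "hyp_term q x a b c z (Suc m) = A * \<alpha> * (B * \<beta>) / (C * \<gamma>) * (Z / (n * D))"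
    by (simp only: hyp_term_def poch_Suc carlitz_D_Suc power_mult_distrib defs defs' greek)
  have t2: "hyp_term q x a b c z m ^ q = A * B / C * (Z / D)"
    by (simp only: hyp_term_def power_mult_distrib power_divide power_q_power_Suc defs defs')
  have "hyp_term q x a b (T_pos q x c) (inverse c * z) m ^ q = A * B / E * (inverse c ^ Q * Z / D)"
    by (simp only: hyp_term_def power_mult_distrib power_divide power_q_power_Suc defs defs')
  also have "\<dots> = - (A * B / (C * \<gamma>) * (Z / D))"
    using nonzero unfolding CE by (simp add: power_inverse divide_simps)
  finally have t3: "hyp_term q x a b (T_pos q x c) (inverse c * z) m ^ q
      = - (A * B / (C * \<gamma>) * (Z / D))" .
  have "hyp_term q x (T_neg q x a) b c (inverse k * z) (Suc m) =
      - (k ^ Q) * A * (B * \<beta>) / (C * \<gamma>) * (inverse k ^ Q * Z / (n * D))"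
    unfolding hyp_term_def poch_Suc_T_neg k(1)[symmetric]
    by (simp only: poch_Suc carlitz_D_Suc power_mult_distrib defs defs' greek)
  also have "\<dots> = - (A * (B * \<beta>) / (C * \<gamma>) * (Z / (n * D)))"
    using nonzero k(2) by (simp add: power_inverse divide_simps)
  finally have t4: "hyp_term q x (T_neg q x a) b c (inverse k * z) (Suc m) =
      - (A * (B * \<beta>) / (C * \<gamma>) * (Z / (n * D)))" .
  \<comment> \<open>With \<open>A * B * Z / (C * \<gamma> * n * D)\<close> taken out,
    \<open>\<alpha> * \<beta> - n * \<gamma> - (\<beta> - \<gamma>) * n + k * \<beta> = \<beta> *
    (\<alpha> - n + k)\<close> remains, which vanishes.\<close>
  show ?thesis
    unfolding t1 t2 t3 t4 e \<alpha> using nonzero by (simp add: divide_simps) (simp add: algebra_simps)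
qed

lemma hyp2F1_T_neg_contiguous:
  assumes c: "admissible q x c" and k: "a ^ q + bracket q x 1 \<noteq> 0"
  shows "\<forall>\<^sub>F z in nhds 0.
    hyp2F1 q x a b c z - hyp2F1 q x a b c z ^ q
      + (c ^ q - b ^ q) * hyp2F1 q x a b (T_pos q x c) (inverse c * z) ^ q
      - (a ^ q + bracket q x 1)
          * hyp2F1 q x (T_neg q x a) b c (inverse (a ^ q + bracket q x 1) * z) = 0"
proof -
  define k where "k = a ^ q + bracket q x 1"
  show ?thesis
    unfolding k_def[symmetric]
    using eventually_hyp_term_sums[OF c, of a b 1]
      eventually_hyp_term_sums[OF admissible_T_pos[OF c], of a b "inverse c"]
      eventually_hyp_term_sums[OF c, of "T_neg q x a" b "inverse k"]
  proof eventually_elim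
    case (elim z)
    let ?t = "hyp_term q x a b c z" and ?u = "hyp_term q x a b (T_pos q x c) (inverse c * z)"
      and ?w = "hyp_term q x (T_neg q x a) b c (inverse k * z)"
    let ?T = "hyp2F1 q x a b c z" and ?U = "hyp2F1 q x a b (T_pos q x c) (inverse c * z)"
      and ?W = "hyp2F1 q x (T_neg q x a) b c (inverse k * z)"
    \<comment> \<open>A \<open>q\<close>-th power of a series starts at \<open>z ^ q\<close>, so its
      terms move up one place and leave 0 at index 0.\<close>
    define s where "s = case_nat 0 (\<lambda>m. (c ^ q - b ^ q) * ?u m ^ q - ?t m ^ q)"
    have t: "?t sums ?T"
      using elim(1) by simp
    have "(\<lambda>m. s (Suc m)) sums ((c ^ q - b ^ q) * ?U ^ q - ?T ^ q)"
      unfolding s_def using vsums_diff[OF vsums_mult[OF power_q_sums[OF elim(2)]] power_q_sums[OF t]]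
      by simp
    from sums_Suc[OF this] have s: "s sums ((c ^ q - b ^ q) * ?U ^ q - ?T ^ q)"
      by (simp add: s_def)
    have "?t m - k * ?w m + s m = 0" for m
    proof (cases m)
      \<comment> \<open>The linear terms are \<open>z\<close> and
        \<open>k * (inverse k * z)\<close>, which cancel since \<open>k\<close> is nonzero.\<close>
      case 0
      then show ?thesis
        using k by (simp add: s_def hyp_term_def poch_0 carlitz_D_def k_def)
    next
      case (Suc j)
      then show ?thesis
        using hyp_term_coefficient_relation[OF c k_def, of b z j] k
        by (simp add: s_def k_def algebra_simps)
    qed
    then have "(\<lambda>m. 0) sums (?T - k * ?W + ((c ^ q - b ^ q) * ?U ^ q - ?T ^ q))"
      using sums_add[OF vsums_diff[OF t vsums_mult[OF elim(3), of k]] s] by simp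
    from sums_unique2[OF this sums_zero] show ?case
      by (simp add: algebra_simps)
  qed
qed

end

section \<open>Specialisation to the completed algebraic closure\<close>

lemma completed_alg_closure_valued_frobenius_field:
  fixes \<iota> :: "'k::{field,finite} fls alg_closure \<Rightarrow> 'c::{valued_field,complete_space}"
  assumes "completed_alg_closure \<iota>"
  shows "valued_frobenius_field CARD('k) (\<iota> (to_ac fls_X))"
proof
  show q2: "2 \<le> CARD('k)" by (rule q_ge_2)
  show "(u + v :: 'c) ^ CARD('k) = u ^ CARD('k) + v ^ CARD('k)" for u v
    by (rule completed_alg_closure_power_add[OF assms])
  show "\<exists>w. w ^ CARD('k) = y" for y :: 'c
    by (rule completed_alg_closure_root_exists[OF assms])
  have "vabs (\<iota> (to_ac fls_X)) = laurent_abs (fls_X :: 'k fls)"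
    using assms by (simp add: completed_alg_closure_def)
  also have "\<dots> = 1 / real CARD('k)"
    by (simp add: laurent_abs_def power_int_minus divide_inverse)
  finally show "0 < vabs (\<iota> (to_ac fls_X))" "vabs (\<iota> (to_ac fls_X)) < 1"
    using q2 by auto
qed

theorem theorem3:
  fixes \<iota> :: "'k::{field,finite} fls alg_closure \<Rightarrow> 'c::{valued_field,complete_space}"
    and q :: nat and x :: 'c
  assumes "completed_alg_closure \<iota>"
    and "q = CARD('k)"
    and "x = \<iota> (to_ac fls_X)"
  shows
    "(\<forall>m\<ge>1. \<forall>a.
        (a \<noteq> 0 \<longrightarrow>
           poch q x (T_pos q x a) m = inverse (a ^ (q ^ m)) * (a - bracket q x m) * poch q x a m) \<and>
        poch q x a (m + 1) = - (a ^ (q ^ (m + 1))) * (poch q x (T_pos q x a) m) ^ q \<and>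
        poch q x (T_neg q x a) m = - ((bracket q x 1 + a ^ q) ^ (q ^ m)) * (poch q x a (m - 1)) ^ q \<and>
        (a \<noteq> bracket q x (m - 1) \<longrightarrow>
           poch q x (T_neg q x a) m =
             - ((bracket q x 1 + a ^ q) ^ (q ^ m) / (bracket q x (m - 1) - a) ^ q) * poch q x a m)) \<and>
     (\<forall>a b c. admissible q x c \<longrightarrow>
        (\<forall>\<^sub>F z in nhds 0.
           hyp2F1 q x (T_pos q x a) b c (a * z) - hyp2F1 q x a (T_pos q x b) c (b * z) =
             (a - b) * hyp2F1 q x a b c z) \<and>
        (a ^ q + bracket q x 1 \<noteq> 0 \<longrightarrow>
          (\<forall>\<^sub>F z in nhds 0.
             hyp2F1 q x a b c z - (hyp2F1 q x a b c z) ^ q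
               + (c ^ q - b ^ q) * (hyp2F1 q x a b (T_pos q x c) (inverse c * z)) ^ q
               - (a ^ q + bracket q x 1)
                   * hyp2F1 q x (T_neg q x a) b c (inverse (a ^ q + bracket q x 1) * z) = 0)))"
proof -
  interpret valued_frobenius_field q x
    unfolding assms(2,3) by (rule completed_alg_closure_valued_frobenius_field[OF assms(1)])
  show ?thesis
  proof (intro conjI allI impI)
    fix m :: nat and a :: 'c
    assume "1 \<le> m"
    then obtain j where j: "m = Suc j" by (cases m) auto
    show "poch q x (T_pos q x a) m = inverse (a ^ (q ^ m)) * (a - bracket q x m) * poch q x a m"
      if "a \<noteq> 0"
      using that poch_T_pos[of a m] by (simp add: field_simps)
    show "poch q x a (m + 1) = - (a ^ (q ^ (m + 1))) * (poch q x (T_pos q x a) m) ^ q"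
      using poch_Suc_T_pos[of a m] by simp
    show neg: "poch q x (T_neg q x a) m =
        - ((bracket q x 1 + a ^ q) ^ (q ^ m)) * (poch q x a (m - 1)) ^ q"
      using poch_Suc_T_neg[of a j] by (simp add: j add.commute)
    show "poch q x (T_neg q x a) m =
        - ((bracket q x 1 + a ^ q) ^ (q ^ m) / (bracket q x (m - 1) - a) ^ q) * poch q x a m"
      if "a \<noteq> bracket q x (m - 1)"
    proof -
      have "(bracket q x (m - 1) - a) ^ q \<noteq> 0"
        using that by simp
      moreover have "poch q x a m = poch q x a (m - 1) ^ q * (bracket q x (m - 1) - a) ^ q"
        by (simp add: j poch_Suc power_mult_distrib)
      ultimately show ?thesis
        unfolding neg using that by simp
    qed
  qed (use hyp2F1_T_pos_contiguous hyp2F1_T_neg_contiguous in blast)+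
qed

end
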